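(* Let the Jacobian linearization of the control-affine system $\dot{x}=f(x)+g(x)u$, $y=h(x)$, $x\in\mathbb{R}^n$, have distinct, nonzero Hankel singular values $\sigma_1,\dots,\sigma_n$, and let $\Sigma=\mathrm{diag}(\sigma_1,\dots,\sigma_n)$. Let $d\ge3$ and let $\tilde v_i,\tilde w_i\in\mathbb{R}^{n^i}$, $i=3,\dots,d$, be the energy function coefficients in the linearly transformed coordinates (see context). Then, for each $k=3,\dots,d$, with $\hat T_1=I_n$ and given the coefficients $\hat T_2,\dots,\hat T_{k-2}$ ($\hat T_i\in\mathbb{R}^{n\times n^i}$), there exists a solution $\hat T_{k-1}\in\mathbb{R}^{n\times n^{k-1}}$ to the system of linear algebraic equations consisting of both $$2N_k\,\mathrm{vec}(\hat T_{k-1})=-N_k\Big(\sum_{\substack{i,j\ge2\\ i+j=k}}\mathrm{vec}(\hat T_j^\top\hat T_i)+\sum_{i=3}^k\hat{\mathcal{T}}_{i,k}^\top\tilde v_i\Big)$$ and $$2\hat N_k\left(I_{n^{k-1}}\otimes\Sigma^2\right)\mathrm{vec}(\hat T_{k-1})=-\hat N_k\Big(\sum_{\substack{i,j\ge2\\ i+j=k}}\mathrm{vec}(\hat T_j^\top\Sigma^2\hat T_i)+\sum_{i=3}^k\hat{\mathcal{T}}_{i,k}^\top\tilde w_i\Big).$$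
   Context: The Jacobian linearization at the origin is minimal and asymptotically stable. The energy functions are $\mathcal{E}_c(x_0)=\min\frac12\int_{-\infty}^0\|u(t)\|^2dt$ over $u\in L_2(-\infty,0)$ with $x(-\infty)=0$, $x(0)=x_0$, and $\mathcal{E}_o(x_0)=\frac12\int_0^\infty\|y(t)\|^2dt$ with $x(0)=x_0$, $u\equiv0$; they are assumed to exist and to have expansions $\mathcal{E}_c(x)=\frac12\sum_{i=2}^dv_i^\top x^{\otimes i}+\dots$ and $\mathcal{E}_o(x)=\frac12\sum_{i=2}^dw_i^\top x^{\otimes i}+\dots$ with $v_i,w_i\in\mathbb{R}^{n^i}$. Let $V_2,W_2$ be the symmetric positive definite matrices with $v_2=\mathrm{vec}(V_2)$, $w_2=\mathrm{vec}(W_2)$, let $V_2=RR^\top$, $W_2=LL^\top$ with square factors, let $L^\top R^{-\top}=\mathcal{U}\Sigma\mathcal{V}^\top$ be a singular value decomposition (the diagonal entries of $\Sigma$ are the Hankel singular values of the linearization), and $T_1=R^{-\top}\mathcal{V}$. The transformed coefficients are $\tilde v_i=(T_1^{\otimes i})^\top v_i$ and $\tilde w_i=(T_1^{\otimes i})^\top w_i$. Notation: $\otimes$ is the Kronecker product, $x^{\otimes k}=x\otimes\dots\otimes x\in\mathbb{R}^{n^k}$ ($k$ factors; likewise for matrices), and $\mathrm{vec}$ stacks the columns of a matrix. For matrices $\hat T_i\in\mathbb{R}^{n\times n^i}$, $$\hat{\mathcal{T}}_{m,l}:=\sum_{i_1+\dots+i_m=l}\hat T_{i_1}\otimes\dots\otimes\hat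 T_{i_m}\in\mathbb{R}^{n^m\times n^l},$$ the sum being over all ordered tuples of positive integers with sum $l$ (so $\hat{\mathcal{T}}_{i,k}$ with $i\ge3$ only involves $\hat T_1,\dots,\hat T_{k-2}$). The matrix $N_k$ is the binary $\binom{n+k-1}{k}\times n^k$ matrix whose rows are indexed by the distinct degree-$k$ monomials in $x_1,\dots,x_n$, with entry $1$ in row $\mu$ and column $j$ exactly when the $j$th entry of $x^{\otimes k}$ equals the monomial $\mu$. The rows are ordered so that the first $n$ correspond to the univariate monomials $x_1^k,\dots,x_n^k$; $\hat N_k$ is the matrix of the remaining rows of $N_k$ (the monomials containing at least two distinct variables). *)

theory Defs
  imports
    "HOL-Analysis.Analysis"
    "HOL-Library.Multiset"
    "Jordan_Normal_Form.Char_Poly"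
begin

unbundle no vec_syntax
no_notation inner (infix "\<bullet>" 70)
hide_type (open) Finite_Cartesian_Product.vec
hide_const (open) Finite_Cartesian_Product.vec Finite_Cartesian_Product.mat

text \<open>All vectors and matrices are those of \<^theory>\<open>Jordan_Normal_Form.Matrix\<close>, with dimensions given
  by natural numbers and indices starting at 0.  This type carries no topology, so analytic notions
  are expressed through coordinates or through the Euclidean norm below.\<close>

definition eucl_norm :: "real vec \<Rightarrow> real" where
  "eucl_norm x = sqrt (x \<bullet> x)"


subsection \<open>Linear systems\<close>

text \<open>The matrix exponential of \<open>t A\<close>, as an entrywise power series.\<close>

definition mat_exp :: "real mat \<Rightarrow> real \<Rightarrow> real mat" where
  "mat_exp A t = mat (dim_row A) (dim_row A)
     (\<lambda>(i, j). \<Sum>k. (A ^\<^sub>m k) $$ (i, j) * t ^ k / fact k)"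

text \<open>Asymptotic stability of the equilibrium 0 of \<open>x' = A x\<close>, whose solutions are \<open>mat_exp A t x\<^sub>0\<close>:
  Lyapunov stability together with attractivity.\<close>

definition asymptotically_stable :: "nat \<Rightarrow> real mat \<Rightarrow> bool" where
  "asymptotically_stable n A \<longleftrightarrow>
     (\<forall>\<epsilon>>0. \<exists>\<delta>>0. \<forall>x\<in>carrier_vec n. eucl_norm x < \<delta> \<longrightarrow>
        (\<forall>t\<ge>0. eucl_norm (mat_exp A t *\<^sub>v x) < \<epsilon>)) \<and>
     (\<forall>x\<in>carrier_vec n. ((\<lambda>t. eucl_norm (mat_exp A t *\<^sub>v x)) \<longlongrightarrow> 0) at_top)"

text \<open>Minimality: no state-space realization of the same impulse response \<open>C e\<^bsup>tA\<^esup> B\<close> has a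
  smaller state dimension.\<close>

definition minimal_realization ::
  "nat \<Rightarrow> nat \<Rightarrow> nat \<Rightarrow> real mat \<Rightarrow> real mat \<Rightarrow> real mat \<Rightarrow> bool" where
  "minimal_realization n m p A B C \<longleftrightarrow>
     (\<forall>n' A' B' C'. A' \<in> carrier_mat n' n' \<longrightarrow> B' \<in> carrier_mat n' m \<longrightarrow> C' \<in> carrier_mat p n' \<longrightarrow>
        (\<forall>t\<ge>0. C' * mat_exp A' t * B' = C * mat_exp A t * B) \<longrightarrow> n \<le> n')"

definition controllability_gramian :: "nat \<Rightarrow> real mat \<Rightarrow> real mat \<Rightarrow> real mat" where
  "controllability_gramian n A B = mat n n (\<lambda>(i, j).
     LINT t:{0..}|lborel.
       (mat_exp A t * B * transpose_mat B * transpose_mat (mat_exp A t)) $$ (i, j))"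

definition observability_gramian :: "nat \<Rightarrow> real mat \<Rightarrow> real mat \<Rightarrow> real mat" where
  "observability_gramian n A C = mat n n (\<lambda>(i, j).
     LINT t:{0..}|lborel.
       (transpose_mat (mat_exp A t) * transpose_mat C * C * mat_exp A t) $$ (i, j))"

text \<open>\<open>\<sigma> 0, \<dots>, \<sigma> (n - 1)\<close> are the square roots of the eigenvalues of the product of the two
  Gramians, listed with multiplicity.\<close>

definition hankel_singular_values ::
  "nat \<Rightarrow> real mat \<Rightarrow> real mat \<Rightarrow> real mat \<Rightarrow> (nat \<Rightarrow> real) \<Rightarrow> bool" where
  "hankel_singular_values n A B C \<sigma> \<longleftrightarrow>
     (\<forall>i<n. 0 \<le> \<sigma> i) \<and>
     char_poly (controllability_gramian n A B * observability_gramian n A C)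
       = (\<Prod>i<n. [:- ((\<sigma> i)\<^sup>2), 1:])"


subsection \<open>Control-affine systems and their energy functions\<close>

definition control_affine_system ::
  "nat \<Rightarrow> nat \<Rightarrow> nat \<Rightarrow> (real vec \<Rightarrow> real vec) \<Rightarrow> (real vec \<Rightarrow> real mat) \<Rightarrow>
   (real vec \<Rightarrow> real vec) \<Rightarrow> bool" where
  "control_affine_system n m p f g h \<longleftrightarrow>
     f \<in> carrier_vec n \<rightarrow> carrier_vec n \<and>
     g \<in> carrier_vec n \<rightarrow> carrier_mat n m \<and>
     h \<in> carrier_vec n \<rightarrow> carrier_vec p"

text \<open>\<open>J\<close> is the matrix of the Frechet derivative of \<open>F : \<real>\<^sup>n \<rightarrow> \<real>\<^sup>q\<close> at the origin.\<close>

definition jacobian_at_origin ::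
  "nat \<Rightarrow> nat \<Rightarrow> (real vec \<Rightarrow> real vec) \<Rightarrow> real mat \<Rightarrow> bool" where
  "jacobian_at_origin n q F J \<longleftrightarrow>
     J \<in> carrier_mat q n \<and>
     (\<forall>\<epsilon>>0. \<exists>\<delta>>0. \<forall>x\<in>carrier_vec n. eucl_norm x < \<delta> \<longrightarrow>
        eucl_norm (F x - F (0\<^sub>v n) - J *\<^sub>v x) \<le> \<epsilon> * eucl_norm x)"

definition linearization_at_origin ::
  "nat \<Rightarrow> nat \<Rightarrow> nat \<Rightarrow> (real vec \<Rightarrow> real vec) \<Rightarrow> (real vec \<Rightarrow> real mat) \<Rightarrow>
   (real vec \<Rightarrow> real vec) \<Rightarrow> real mat \<Rightarrow> real mat \<Rightarrow> real mat \<Rightarrow> bool" where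
  "linearization_at_origin n m p f g h A B C \<longleftrightarrow>
     jacobian_at_origin n n f A \<and> B = g (0\<^sub>v n) \<and> jacobian_at_origin n p h C"

text \<open>Since controls are only square integrable, \<open>x' = f(x) + g(x) u\<close> is understood in the sense
  of Caratheodory, that is, in integrated form.\<close>

definition trajectory ::
  "nat \<Rightarrow> (real vec \<Rightarrow> real vec) \<Rightarrow> (real vec \<Rightarrow> real mat) \<Rightarrow> real set \<Rightarrow>
   (real \<Rightarrow> real vec) \<Rightarrow> (real \<Rightarrow> real vec) \<Rightarrow> bool" where
  "trajectory n f g I u x \<longleftrightarrow>
     (\<forall>t\<in>I. x t \<in> carrier_vec n) \<and>
     (\<forall>s\<in>I. \<forall>t\<in>I. s \<le> t \<longrightarrow> (\<forall>i<n.
        set_integrable lborel {s..t} (\<lambda>r. (f (x r) + g (x r) *\<^sub>v u r) $ i) \<and>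
        x t $ i = x s $ i + (LINT r:{s..t}|lborel. (f (x r) + g (x r) *\<^sub>v u r) $ i)))"

definition L2_control :: "nat \<Rightarrow> real set \<Rightarrow> (real \<Rightarrow> real vec) \<Rightarrow> bool" where
  "L2_control m I u \<longleftrightarrow>
     (\<forall>t\<in>I. u t \<in> carrier_vec m) \<and>
     (\<forall>j<m. set_borel_measurable lborel I (\<lambda>t. u t $ j) \<and>
             set_integrable lborel I (\<lambda>t. (u t $ j)\<^sup>2))"

definition steers_from_rest ::
  "nat \<Rightarrow> nat \<Rightarrow> (real vec \<Rightarrow> real vec) \<Rightarrow> (real vec \<Rightarrow> real mat) \<Rightarrow> real vec \<Rightarrow>
   (real \<Rightarrow> real vec) \<Rightarrow> bool" where
  "steers_from_rest n m f g x0 u \<longleftrightarrow>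
     L2_control m {..0} u \<and>
     (\<exists>x. trajectory n f g {..0} u x \<and>
          ((\<lambda>t. eucl_norm (x t)) \<longlongrightarrow> 0) at_bot \<and> x 0 = x0)"

text \<open>The value \<open>e\<close> is the (attained) minimal control energy for reaching \<open>x0\<close>.\<close>

definition controllability_energy ::
  "nat \<Rightarrow> nat \<Rightarrow> (real vec \<Rightarrow> real vec) \<Rightarrow> (real vec \<Rightarrow> real mat) \<Rightarrow> real vec \<Rightarrow> real \<Rightarrow> bool" where
  "controllability_energy n m f g x0 e \<longleftrightarrow>
     (\<exists>u. steers_from_rest n m f g x0 u \<and>
          e = 1/2 * (LINT t:{..0}|lborel. (eucl_norm (u t))\<^sup>2)) \<and>
     (\<forall>u. steers_from_rest n m f g x0 u \<longrightarrow>
          e \<le> 1/2 * (LINT t:{..0}|lborel. (eucl_norm (u t))\<^sup>2))"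

text \<open>The value \<open>e\<close> is the output energy of the uncontrolled system started in \<open>x0\<close>; it has to be
  the same for every such trajectory, should there be more than one.\<close>

definition observability_energy ::
  "nat \<Rightarrow> nat \<Rightarrow> (real vec \<Rightarrow> real vec) \<Rightarrow> (real vec \<Rightarrow> real mat) \<Rightarrow> (real vec \<Rightarrow> real vec) \<Rightarrow>
   real vec \<Rightarrow> real \<Rightarrow> bool" where
  "observability_energy n m f g h x0 e \<longleftrightarrow>
     (\<exists>x. trajectory n f g {0..} (\<lambda>_. 0\<^sub>v m) x \<and> x 0 = x0) \<and>
     (\<forall>x. trajectory n f g {0..} (\<lambda>_. 0\<^sub>v m) x \<and> x 0 = x0 \<longrightarrow>
          set_integrable lborel {0..} (\<lambda>t. (eucl_norm (h (x t)))\<^sup>2) \<and>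
          e = 1/2 * (LINT t:{0..}|lborel. (eucl_norm (h (x t)))\<^sup>2))"

definition near_origin :: "nat \<Rightarrow> (real vec \<Rightarrow> bool) \<Rightarrow> bool" where
  "near_origin n P \<longleftrightarrow> (\<exists>\<delta>>0. \<forall>x\<in>carrier_vec n. eucl_norm x < \<delta> \<longrightarrow> P x)"


subsection \<open>Kronecker products and vectorization\<close>

definition kron :: "'a :: semiring_1 mat \<Rightarrow> 'a mat \<Rightarrow> 'a mat" where
  "kron A B = mat (dim_row A * dim_row B) (dim_col A * dim_col B)
     (\<lambda>(i, j). A $$ (i div dim_row B, j div dim_col B) * B $$ (i mod dim_row B, j mod dim_col B))"

definition kron_list :: "'a :: semiring_1 mat list \<Rightarrow> 'a mat" where
  "kron_list As = foldr kron As (1\<^sub>m 1)"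

definition kron_pow :: "'a :: semiring_1 mat \<Rightarrow> nat \<Rightarrow> 'a mat" where
  "kron_pow A k = kron_list (replicate k A)"

definition kron_vec :: "'a :: semiring_1 vec \<Rightarrow> 'a vec \<Rightarrow> 'a vec" where
  "kron_vec x y = vec (dim_vec x * dim_vec y) (\<lambda>i. x $ (i div dim_vec y) * y $ (i mod dim_vec y))"

definition kron_vec_pow :: "'a :: semiring_1 vec \<Rightarrow> nat \<Rightarrow> 'a vec" where
  "kron_vec_pow x k = foldr kron_vec (replicate k x) (vec 1 (\<lambda>_. 1))"

text \<open>Column stacking.\<close>

definition vectorize :: "'a mat \<Rightarrow> 'a vec" where
  "vectorize M = vec (dim_row M * dim_col M) (\<lambda>i. M $$ (i mod dim_row M, i div dim_row M))"

text \<open>\<open>E(x) = 1/2 (c\<^sub>2\<^sup>T x\<^bsup>\<otimes>2\<^esup> + \<dots> + c\<^sub>d\<^sup>T x\<^bsup>\<otimes>d\<^esup>) + o(\<parallel>x\<parallel>\<^sup>d)\<close> as \<open>x \<rightarrow> 0\<close>.\<close>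

definition energy_expansion ::
  "nat \<Rightarrow> nat \<Rightarrow> (real vec \<Rightarrow> real) \<Rightarrow> (nat \<Rightarrow> real vec) \<Rightarrow> bool" where
  "energy_expansion n d E c \<longleftrightarrow>
     (\<forall>i\<in>{2..d}. c i \<in> carrier_vec (n ^ i)) \<and>
     (\<forall>\<epsilon>>0. near_origin n (\<lambda>x.
        \<bar>E x - 1/2 * (\<Sum>i=2..d. c i \<bullet> kron_vec_pow x i)\<bar> \<le> \<epsilon> * eucl_norm x ^ d))"


subsection \<open>Balancing of the quadratic parts\<close>

definition sym_pos_def :: "nat \<Rightarrow> real mat \<Rightarrow> bool" where
  "sym_pos_def n M \<longleftrightarrow>
     M \<in> carrier_mat n n \<and> transpose_mat M = M \<and>
     (\<forall>x\<in>carrier_vec n. x \<noteq> 0\<^sub>v n \<longrightarrow> 0 < x \<bullet> (M *\<^sub>v x))"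

text \<open>The library constant \<^const>\<open>orthogonal_mat\<close> only requires nonzero orthogonal columns, hence
  orthogonality is spelled out.\<close>

definition singular_value_decomposition ::
  "nat \<Rightarrow> real mat \<Rightarrow> real mat \<Rightarrow> (nat \<Rightarrow> real) \<Rightarrow> real mat \<Rightarrow> bool" where
  "singular_value_decomposition n M U \<sigma> V \<longleftrightarrow>
     U \<in> carrier_mat n n \<and> transpose_mat U * U = 1\<^sub>m n \<and>
     V \<in> carrier_mat n n \<and> transpose_mat V * V = 1\<^sub>m n \<and>
     (\<forall>i<n. 0 \<le> \<sigma> i) \<and>
     M = U * mat_diag n \<sigma> * transpose_mat V"


subsection \<open>The matrices of the coefficient equations\<close>

definition compositions :: "nat \<Rightarrow> nat \<Rightarrow> nat list set" where
  "compositions m l = {is. length is = m \<and> (\<forall>i\<in>set is. 1 \<le> i) \<and> sum_list is = l}"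

definition cal_T :: "nat \<Rightarrow> (nat \<Rightarrow> real mat) \<Rightarrow> nat \<Rightarrow> nat \<Rightarrow> real mat" where
  "cal_T n T m l = mat (n ^ m) (n ^ l)
     (\<lambda>(r, c). \<Sum>is\<in>compositions m l. kron_list (map T is) $$ (r, c))"

text \<open>A monomial is given by the multiset of the indices of its variables.\<close>

definition monomials :: "nat \<Rightarrow> nat \<Rightarrow> nat multiset set" where
  "monomials n k = {\<mu>. size \<mu> = k \<and> set_mset \<mu> \<subseteq> {..<n}}"

definition eval_monomial :: "nat multiset \<Rightarrow> real vec \<Rightarrow> real" where
  "eval_monomial \<mu> x = (\<Prod>i\<in>#\<mu>. x $ i)"

text \<open>The admissible row orders: all monomials of degree \<open>k\<close>, the \<open>n\<close> univariate ones first.\<close>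

definition monomial_order :: "nat \<Rightarrow> nat \<Rightarrow> nat multiset list \<Rightarrow> bool" where
  "monomial_order n k ms \<longleftrightarrow>
     distinct ms \<and> set ms = monomials n k \<and>
     take n ms = map (\<lambda>i. replicate_mset k i) [0..<n]"

text \<open>Rows indexed by a list of monomials; a monomial equals an entry of \<open>x\<^bsup>\<otimes>k\<^esup>\<close> if both agree as
  functions of \<open>x\<close>.\<close>

definition monomial_matrix :: "nat \<Rightarrow> nat \<Rightarrow> nat multiset list \<Rightarrow> real mat" where
  "monomial_matrix n k ms = mat (length ms) (n ^ k)
     (\<lambda>(r, j). if \<forall>x\<in>carrier_vec n. kron_vec_pow x k $ j = eval_monomial (ms ! r) x
               then 1 else 0)"

definition N_mat :: "nat \<Rightarrow> nat \<Rightarrow> nat multiset list \<Rightarrow> real mat" where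
  "N_mat n k ms = monomial_matrix n k ms"

definition N_hat_mat :: "nat \<Rightarrow> nat \<Rightarrow> nat multiset list \<Rightarrow> real mat" where
  "N_hat_mat n k ms = monomial_matrix n k (drop n ms)"

end

theory Submission
  imports Defs
begin

text \<open>The right-hand sides play no role: both systems decouple over the monomials of degree \<open>k\<close>.
  The unknown \<open>vectorize X\<close> has one entry for each position of \<open>x\<^bsup>\<otimes>k\<^esup>\<close>, and
  \<open>I \<otimes> \<Sigma>\<^sup>2\<close> weights that entry by \<open>(\<sigma> a)\<^sup>2\<close>, where \<open>a\<close> is the index of the last factor
  at that position.  The positions of a monomial impose only one equation on a univariate monomial,
  and two on a monomial containing distinct variables \<open>a\<close>, \<open>b\<close>.  The latter are solved by two
  positions, ending in \<open>a\<close> and in \<open>b\<close>, since \<open>(\<sigma> a)\<^sup>2 \<noteq> (\<sigma> b)\<^sup>2\<close>.\<close>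

section \<open>Positions of a monomial in a Kronecker power: the support of its row of
  \<open>N_mat\<close>\<close>

definition monomial_positions :: "nat \<Rightarrow> nat \<Rightarrow> nat multiset \<Rightarrow> nat set" where
  "monomial_positions n k \<mu> =
     {j. j < n ^ k \<and> (\<forall>x\<in>carrier_vec n. kron_vec_pow x k $ j = eval_monomial \<mu> x)}"

lemma finite_monomial_positions: "finite (monomial_positions n k \<mu>)"
  unfolding monomial_positions_def by auto

lemma dim_kron_vec_pow [simp]: "dim_vec (kron_vec_pow x k) = dim_vec x ^ k"
  by (induction k) (auto simp: kron_vec_pow_def kron_vec_def)

lemma kron_vec_pow_Suc: "kron_vec_pow x (Suc k) = kron_vec x (kron_vec_pow x k)"
  by (simp add: kron_vec_pow_def)

text \<open>The base-\<open>n\<close> digits of a position, leading digit first, are the indices of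
  the factors at that position. The induction prepends a leading digit, which \<open>div\<close> and
  \<open>mod\<close> by the power of \<open>n\<close> separate from the rest.\<close>

lemma monomial_position_of_list:
  assumes "set is \<subseteq> {..<n}"
  shows "\<exists>j\<in>monomial_positions n (length is) (mset is). is \<noteq> [] \<longrightarrow> j mod n = last is"
  using assms
proof (induction "is")
  case Nil
  then show ?case
    by (auto simp: monomial_positions_def kron_vec_pow_def eval_monomial_def)
next
  case (Cons a "is")
  let ?k = "length is"
  from Cons obtain j where j: "j < n ^ ?k"
      "\<And>x. x \<in> carrier_vec n \<Longrightarrow> kron_vec_pow x ?k $ j = eval_monomial (mset is) x"
      "is \<noteq> [] \<longrightarrow> j mod n = last is"
    by (auto simp: monomial_positions_def)
  have a: "a < n" using Cons by auto
  let ?j = "a * n ^ ?k + j"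
  have "?j < (a + 1) * n ^ ?k" using j(1) by simp
  also have "\<dots> \<le> n ^ Suc ?k" using a by (simp add: mult_le_mono1 del: add_Suc_right)
  finally have lt: "?j < n ^ Suc ?k" .
  have "(a * q + j) div q = a \<and> (a * q + j) mod q = j" if "j < q" for q
    using that by auto
  from this[OF j(1)] have dm: "?j div n ^ ?k = a" "?j mod n ^ ?k = j" by blast+
  have "kron_vec_pow x (Suc ?k) $ ?j = eval_monomial (mset (a # is)) x"
    if "x \<in> carrier_vec n" for x
    using that lt dm j(2)[OF that]
    by (auto simp: kron_vec_pow_Suc kron_vec_def eval_monomial_def)
  moreover have "?j mod n = last (a # is)"
  proof (cases "is")
    case Nil
    then show ?thesis using j(1) a by simp
  next
    case (Cons b bs)
    \<comment> \<open>Below a nonempty tail the new leading digit contributes a multiple of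
      \<open>n\<close>, so the last digit stays that of \<open>j\<close>.\<close>
    then have "?j = j + n * (a * n ^ length bs)" by (simp add: algebra_simps)
    then have "?j mod n = j mod n" by (simp only: mod_mult_self2)
    then show ?thesis using j(3) Cons by simp
  qed
  ultimately show ?case using lt
    by (intro bexI[of _ ?j]) (auto simp: monomial_positions_def)
qed

text \<open>Listing the other factors first puts any chosen variable in last place. Two distinct
  variables of a monomial thus yield two unknowns with different weights.\<close>

lemma monomial_position_with_last:
  assumes "\<mu> \<in> monomials n k" "a \<in># \<mu>"
  obtains j where "j \<in> monomial_positions n k \<mu>" "j mod n = a"
proof -
  obtain xs where xs: "mset xs = \<mu> - {#a#}" using ex_mset by blast
  then have eq: "mset (xs @ [a]) = \<mu>" using assms(2) by simp
  have "length (xs @ [a]) = size \<mu>" "set (xs @ [a]) = set_mset \<mu>"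
    unfolding eq[symmetric] by (simp_all only: size_mset set_mset_mset)
  then have "length (xs @ [a]) = k" "set (xs @ [a]) \<subseteq> {..<n}"
    using assms(1) unfolding monomials_def by blast+
  with eq show thesis
    using monomial_position_of_list[of "xs @ [a]" n] that by auto
qed

text \<open>Setting variable \<open>i\<close> to 2 and all others to 1 turns a monomial into 2 to
  the power of its multiplicity at \<open>i\<close>, so the values determine all
  multiplicities.\<close>

lemma eval_monomial_inject:
  assumes "set_mset \<mu> \<subseteq> {..<n}" "set_mset \<nu> \<subseteq> {..<n}"
    and eq: "\<And>x. x \<in> carrier_vec n \<Longrightarrow> eval_monomial \<mu> x = eval_monomial \<nu> x"
  shows "\<mu> = \<nu>"
proof (rule multiset_eqI)
  fix i
  have ev: "eval_monomial \<kappa> (vec n (\<lambda>l. if l = i then 2 else 1)) = 2 ^ count \<kappa> i"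
    if "set_mset \<kappa> \<subseteq> {..<n}" for \<kappa>
    using that by (induction \<kappa>) (auto simp: eval_monomial_def)
  have "(2::real) ^ count \<mu> i = 2 ^ count \<nu> i"
    using ev[OF assms(1)] ev[OF assms(2)] eq[of "vec n (\<lambda>l. if l = i then 2 else 1)"] by simp
  then show "count \<mu> i = count \<nu> i" by simp
qed

text \<open>This is the decoupling: no unknown occurs in the equations of two monomials, so
  solutions found separately can be glued.\<close>

lemma monomial_positions_disjoint:
  assumes "\<mu> \<in> monomials n k" "\<nu> \<in> monomials n k"
    and "j \<in> monomial_positions n k \<mu>" "j \<in> monomial_positions n k \<nu>"
  shows "\<mu> = \<nu>"
  using assms by (intro eval_monomial_inject[of \<mu> n \<nu>]) (auto simp: monomials_def monomial_positions_def)

section \<open>Products with the monomial and weight matrices\<close>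

lemma monomial_matrix_mult_vec:
  assumes "z \<in> carrier_vec (n ^ k)"
  shows "monomial_matrix n k ms *\<^sub>v z =
    vec (length ms) (\<lambda>r. \<Sum>j\<in>monomial_positions n k (ms ! r). z $ j)"
proof (rule eq_vecI)
  fix r assume "r < dim_vec (vec (length ms) (\<lambda>r. \<Sum>j\<in>monomial_positions n k (ms ! r). z $ j))"
  then have r: "r < length ms" by simp
  let ?P = "\<lambda>j. \<forall>x\<in>carrier_vec n. kron_vec_pow x k $ j = eval_monomial (ms ! r) x"
  have "(monomial_matrix n k ms *\<^sub>v z) $ r = (\<Sum>j\<in>{0..<n ^ k}. (if ?P j then 1 else 0) * z $ j)"
    using r assms by (auto simp: monomial_matrix_def scalar_prod_def intro!: sum.cong)
  also have "\<dots> = (\<Sum>j\<in>{0..<n ^ k}. if ?P j then z $ j else 0)"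
    by (intro sum.cong) auto
  also have "\<dots> = (\<Sum>j\<in>{j\<in>{0..<n ^ k}. ?P j}. z $ j)"
    by (simp only: sum.inter_filter finite_atLeastLessThan)
  also have "{j\<in>{0..<n ^ k}. ?P j} = monomial_positions n k (ms ! r)"
    by (auto simp: monomial_positions_def)
  finally show "(monomial_matrix n k ms *\<^sub>v z) $ r =
      vec (length ms) (\<lambda>r. \<Sum>j\<in>monomial_positions n k (ms ! r). z $ j) $ r"
    using r by simp
qed (simp add: monomial_matrix_def)

text \<open>The identity factor forces equal quotients by \<open>n\<close> and the diagonal factor
  equal remainders. Under column stacking \<open>i mod n\<close> is the row of the unknown matrix;
  it is also the last base-\<open>n\<close> digit of the position.\<close>

lemma kron_one_mat_diag:
  "kron (1\<^sub>m q) (mat_diag n s) = mat_diag (q * n) (\<lambda>i. s (i mod n) :: real)"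
proof (rule eq_matI)
  fix i j assume "i < dim_row (mat_diag (q * n) (\<lambda>i. s (i mod n)))"
    "j < dim_col (mat_diag (q * n) (\<lambda>i. s (i mod n)))"
  then have ij: "i < q * n" "j < q * n" by (auto simp: mat_diag_def)
  then have n: "n > 0" by (cases n) auto
  have d: "i div n < q" "j div n < q" using ij by (auto simp: less_mult_imp_div_less)
  have "i = j \<longleftrightarrow> i div n = j div n \<and> i mod n = j mod n"
    by (metis div_mult_mod_eq)
  then show "kron (1\<^sub>m q) (mat_diag n s) $$ (i, j) = mat_diag (q * n) (\<lambda>i. s (i mod n)) $$ (i, j)"
    using ij d n by (auto simp: kron_def mat_diag_def)
qed (auto simp: kron_def mat_diag_def)

lemma mat_diag_mult_vec:
  assumes "z \<in> carrier_vec q"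
  shows "mat_diag q s *\<^sub>v z = vec q (\<lambda>i. s i * z $ i :: real)"
proof (rule eq_vecI)
  fix i assume "i < dim_vec (vec q (\<lambda>i. s i * z $ i))"
  then have i: "i < q" by simp
  have "(mat_diag q s *\<^sub>v z) $ i = (\<Sum>j\<in>{0..<q}. (if i = j then s j else 0) * z $ j)"
    using i assms by (simp add: mat_diag_def scalar_prod_def)
  also have "\<dots> = (\<Sum>j\<in>{0..<q}. if i = j then s j * z $ j else 0)"
    by (intro sum.cong) auto
  finally have "(mat_diag q s *\<^sub>v z) $ i = (\<Sum>j\<in>{0..<q}. if i = j then s j * z $ j else 0)" .
  then show "(mat_diag q s *\<^sub>v z) $ i = vec q (\<lambda>i. s i * z $ i) $ i"
    using i by simp
qed (simp add: mat_diag_def)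

section \<open>Solving the equations of one monomial\<close>

lemma ex_weighted_sums_eq:
  fixes t :: "'a \<Rightarrow> real"
  assumes "finite S" "a \<in> S" "b \<in> S" "t a \<noteq> t b"
  shows "\<exists>y. (\<Sum>j\<in>S. y j) = \<beta> \<and> (\<Sum>j\<in>S. t j * y j) = \<gamma>"
proof -
  \<comment> \<open>Cramer's rule for the two unknowns at \<open>a\<close> and \<open>b\<close>,
    with all other unknowns set to zero.\<close>
  let ?ya = "(\<gamma> - t b * \<beta>) / (t a - t b)" and ?yb = "(t a * \<beta> - \<gamma>) / (t a - t b)"
  let ?y = "\<lambda>j. if j = a then ?ya else if j = b then ?yb else 0"
  have ab: "a \<noteq> b" "t a - t b \<noteq> 0" using assms(4) by auto
  have sum: "(\<Sum>j\<in>S. c j * ?y j) = c a * ?ya + c b * ?yb" for c :: "'a \<Rightarrow> real"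
  proof -
    have "(\<Sum>j\<in>S. c j * ?y j) = (\<Sum>j\<in>{a, b}. c j * ?y j)"
      using assms by (intro sum.mono_neutral_right) auto
    then show ?thesis using ab by simp
  qed
  have "?ya + ?yb = \<beta>" "t a * ?ya + t b * ?yb = \<gamma>"
    using ab(2) by (auto simp: divide_simps) (auto simp: algebra_simps)
  then show ?thesis using sum[of "\<lambda>_. 1"] sum[of t] by (intro exI[of _ ?y]) simp
qed

lemma ex_monomial_solution:
  fixes s :: "nat \<Rightarrow> real"
  assumes "inj_on s {..<n}" "k > 0" and \<mu>: "\<mu> \<in> monomials n k"
  shows "\<exists>y. (\<Sum>j\<in>monomial_positions n k \<mu>. y j) = \<beta> \<and>
    (\<mu> \<notin> range (replicate_mset k) \<longrightarrow> (\<Sum>j\<in>monomial_positions n k \<mu>. s (j mod n) * y j) = \<gamma>)"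
proof -
  let ?S = "monomial_positions n k \<mu>"
  have size: "size \<mu> = k" and sub: "set_mset \<mu> \<subseteq> {..<n}"
    using \<mu> by (auto simp: monomials_def)
  then obtain a where a: "a \<in># \<mu>" using \<open>k > 0\<close> by (metis multiset_nonemptyE size_empty less_irrefl)
  obtain i where i: "i \<in> ?S" "i mod n = a" using monomial_position_with_last[OF \<mu> a] .
  show ?thesis
  proof (cases "\<mu> \<in> range (replicate_mset k)")
    \<comment> \<open>A pure power has only the unweighted equation to satisfy, so one position
      carries the whole value.\<close>
    case True
    have "(\<Sum>j\<in>?S. if j = i then \<beta> else 0) = \<beta>"
      using i(1) finite_monomial_positions by simp
    with True show ?thesis by blast
  next
    \<comment> \<open>A multiset of size \<open>k\<close> supported on \<open>a\<close> alone would
      be a pure power, so a second variable \<open>b\<close> occurs, and injectivity of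
      \<open>s\<close> separates the two weights.\<close>
    case False
    then have "\<not> set_mset \<mu> \<subseteq> {a}"
      using size by (metis rangeI set_mset_subset_singletonD)
    then obtain b where b: "b \<in># \<mu>" "b \<noteq> a" by blast
    obtain l where l: "l \<in> ?S" "l mod n = b" using monomial_position_with_last[OF \<mu> b(1)] .
    have "s (i mod n) \<noteq> s (l mod n)"
      using assms(1) a b sub i l by (auto dest: inj_onD)
    from ex_weighted_sums_eq[of ?S i l "\<lambda>j. s (j mod n)", OF finite_monomial_positions i(1) l(1) this]
    show ?thesis by blast
  qed
qed

section \<open>Assembling a coefficient matrix from the monomial solutions\<close>

lemma vectorize_mat_of_function:
  assumes "k > 0"
  shows "vectorize (mat n (n ^ (k - 1)) (\<lambda>(r, c). y (c * n + r))) = vec (n ^ k) y"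
proof -
  have "n * n ^ (k - 1) = n ^ k" using assms by (cases k) auto
  moreover have "i mod n < n \<and> i div n < n ^ (k - 1)" if "i < n ^ k" for i
  proof -
    have "n > 0" using that assms by (cases n) (auto simp: power_0_left)
    moreover have "i < n ^ (k - 1) * n" using that calculation \<open>n * n ^ (k - 1) = n ^ k\<close>
      by (simp add: mult.commute)
    ultimately show ?thesis by (auto simp: less_mult_imp_div_less)
  qed
  ultimately show ?thesis by (intro eq_vecI) (auto simp: vectorize_def)
qed

text \<open>The first \<open>n\<close> entries already contain every pure power, and distinctness
  keeps them from recurring later.\<close>

lemma monomial_order_drop_not_univariate:
  assumes "monomial_order n k ms" "\<mu> \<in> set (drop n ms)"
  shows "\<mu> \<in> monomials n k" "k > 0 \<Longrightarrow> \<mu> \<notin> range (replicate_mset k)"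
proof -
  have ms: "distinct ms" "set ms = monomials n k" "take n ms = map (replicate_mset k) [0..<n]"
    using assms(1) by (auto simp: monomial_order_def)
  show \<mu>: "\<mu> \<in> monomials n k" using assms(2) ms(2) in_set_dropD by metis
  assume "k > 0"
  show "\<mu> \<notin> range (replicate_mset k)"
  proof
    assume "\<mu> \<in> range (replicate_mset k)"
    then obtain a where a: "\<mu> = replicate_mset k a" by blast
    \<comment> \<open>Positive \<open>k\<close> makes \<open>a\<close> occur in the multiset, so
      that membership in \<open>monomials\<close> bounds it.\<close>
    then have "a < n" using \<mu> \<open>k > 0\<close> by (auto simp: monomials_def split: if_splits)
    then have "\<mu> \<in> set (take n ms)" using a ms(3) by auto
    then show False
      using assms(2) ms(1) set_take_disj_set_drop_if_distinct[of ms n n] by blast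
  qed
qed

text \<open>Both right-hand sides are images under the monomial matrices, so each row compares sums
  over the positions of a single monomial. Here \<open>s\<close> stands for the squared singular
  values.\<close>

lemma ex_coefficient_solution:
  fixes s :: "nat \<Rightarrow> real"
  assumes inj: "inj_on s {..<n}" and k: "k > 0" and ms: "monomial_order n k ms"
    and b: "b \<in> carrier_vec (n ^ k)" and c: "c \<in> carrier_vec (n ^ k)"
  shows "\<exists>X\<in>carrier_mat n (n ^ (k - 1)).
    2 \<cdot>\<^sub>v (N_mat n k ms *\<^sub>v vectorize X) = - (N_mat n k ms *\<^sub>v b) \<and>
    2 \<cdot>\<^sub>v ((N_hat_mat n k ms * kron (1\<^sub>m (n ^ (k - 1))) (mat_diag n s)) *\<^sub>v vectorize X)
      = - (N_hat_mat n k ms *\<^sub>v c)"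
proof -
  let ?P = "monomial_positions n k"
  let ?Q = "\<lambda>\<mu> y. (\<Sum>j\<in>?P \<mu>. y j) = - (\<Sum>j\<in>?P \<mu>. b $ j) / 2 \<and>
    (\<mu> \<notin> range (replicate_mset k) \<longrightarrow>
      (\<Sum>j\<in>?P \<mu>. s (j mod n) * y j) = - (\<Sum>j\<in>?P \<mu>. c $ j) / 2)"
  have "\<forall>\<mu>\<in>monomials n k. \<exists>y. ?Q \<mu> y"
    using ex_monomial_solution[OF inj k] by blast
  from bchoice[OF this] obtain Y where "\<forall>\<mu>\<in>monomials n k. ?Q \<mu> (Y \<mu>)" ..
  then have Y: "?Q \<mu> (Y \<mu>)" if "\<mu> \<in> monomials n k" for \<mu>
    using that by (rule bspec)
  \<comment> \<open>By disjointness the choice returns the one monomial owning position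
    \<open>j\<close>. At an index owned by no monomial the value is arbitrary and enters no
    sum.\<close>
  define y where "y j = Y (SOME \<mu>. \<mu> \<in> monomials n k \<and> j \<in> ?P \<mu>) j" for j
  have y: "y j = Y \<mu> j" if "\<mu> \<in> monomials n k" "j \<in> ?P \<mu>" for \<mu> j
  proof -
    have "(SOME \<nu>. \<nu> \<in> monomials n k \<and> j \<in> ?P \<nu>) = \<mu>"
      using that monomial_positions_disjoint by (intro some_equality) blast+
    then show ?thesis by (simp add: y_def)
  qed
  have sol: "?Q \<mu> y" if "\<mu> \<in> monomials n k" for \<mu>
    using Y[OF that] y[OF that] by simp
  \<comment> \<open>Undoes column stacking: coordinate \<open>c * n + r\<close> of the solution
    becomes entry \<open>(r, c)\<close>.\<close>
  let ?X = "mat n (n ^ (k - 1)) (\<lambda>(r, c). y (c * n + r))"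
  have vX: "vectorize ?X = vec (n ^ k) y" by (rule vectorize_mat_of_function[OF k])
  have nk: "n ^ (k - 1) * n = n ^ k" using k by (cases k) auto
  have P: "j < n ^ k" if "j \<in> ?P \<mu>" for j \<mu> using that by (simp add: monomial_positions_def)
  have N: "2 \<cdot>\<^sub>v (N_mat n k ms *\<^sub>v vectorize ?X) = - (N_mat n k ms *\<^sub>v b)"
  proof (rule eq_vecI)
    fix r assume "r < dim_vec (- (N_mat n k ms *\<^sub>v b))"
    then have r: "r < length ms" by (simp add: N_mat_def monomial_matrix_def)
    then have "ms ! r \<in> monomials n k" using ms nth_mem by (auto simp: monomial_order_def)
    from sol[OF this]
    show "(2 \<cdot>\<^sub>v (N_mat n k ms *\<^sub>v vectorize ?X)) $ r = (- (N_mat n k ms *\<^sub>v b)) $ r"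
      using r P unfolding vX by (simp add: N_mat_def monomial_matrix_mult_vec b)
  qed (simp add: N_mat_def)
  have diag: "kron (1\<^sub>m (n ^ (k - 1))) (mat_diag n s) = mat_diag (n ^ k) (\<lambda>i. s (i mod n))"
    unfolding kron_one_mat_diag nk ..
  \<comment> \<open>Moving the diagonal factor onto the vector turns the second system into weighted
    sums over positions.\<close>
  have Nh_mult: "(N_hat_mat n k ms * kron (1\<^sub>m (n ^ (k - 1))) (mat_diag n s)) *\<^sub>v vectorize ?X
    = N_hat_mat n k ms *\<^sub>v vec (n ^ k) (\<lambda>i. s (i mod n) * y i)" (is "?l = ?r")
  proof -
    have "?l = N_hat_mat n k ms *\<^sub>v (mat_diag (n ^ k) (\<lambda>i. s (i mod n)) *\<^sub>v vec (n ^ k) y)"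
      unfolding diag vX
      by (rule assoc_mult_mat_vec[of _ "length ms - n" "n ^ k" _ "n ^ k"])
        (auto simp: N_hat_mat_def monomial_matrix_def mat_diag_def)
    also have "mat_diag (n ^ k) (\<lambda>i. s (i mod n)) *\<^sub>v vec (n ^ k) y
        = vec (n ^ k) (\<lambda>i. s (i mod n) * y i)"
      by (subst mat_diag_mult_vec) auto
    finally show ?thesis .
  qed
  have N_hat: "2 \<cdot>\<^sub>v ((N_hat_mat n k ms * kron (1\<^sub>m (n ^ (k - 1))) (mat_diag n s)) *\<^sub>v vectorize ?X)
      = - (N_hat_mat n k ms *\<^sub>v c)"
    unfolding Nh_mult
  proof (rule eq_vecI)
    fix r assume "r < dim_vec (- (N_hat_mat n k ms *\<^sub>v c))"
    then have r: "r < length (drop n ms)" by (simp add: N_hat_mat_def monomial_matrix_def)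
    define \<mu> where "\<mu> = drop n ms ! r"
    have "\<mu> \<in> set (drop n ms)" using r unfolding \<mu>_def by (rule nth_mem)
    from monomial_order_drop_not_univariate[OF ms this] k
    have "(\<Sum>j\<in>?P \<mu>. s (j mod n) * y j) = - (\<Sum>j\<in>?P \<mu>. c $ j) / 2"
      using sol[of \<mu>] by blast
    then show "(2 \<cdot>\<^sub>v (N_hat_mat n k ms *\<^sub>v vec (n ^ k) (\<lambda>i. s (i mod n) * y i))) $ r
        = (- (N_hat_mat n k ms *\<^sub>v c)) $ r"
      using r P by (simp add: N_hat_mat_def monomial_matrix_mult_vec c \<mu>_def[symmetric] del: nth_drop)
  qed (simp add: N_hat_mat_def)
  show ?thesis by (rule bexI[of _ ?X]) (rule conjI[OF N N_hat], simp)
qed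

theorem theorem3:
  fixes n m p d :: nat
    and f :: "real vec \<Rightarrow> real vec" and g :: "real vec \<Rightarrow> real mat" and h :: "real vec \<Rightarrow> real vec"
    and A B C :: "real mat"
    and \<sigma> :: "nat \<Rightarrow> real"
    and Ec Eo :: "real vec \<Rightarrow> real"
    and v w v' w' :: "nat \<Rightarrow> real vec"
    and V2 W2 R Rinv L U V T1 :: "real mat"
  assumes system: "control_affine_system n m p f g h"
    and linearization: "linearization_at_origin n m p f g h A B C"
    and minimal: "minimal_realization n m p A B C"
    and stable: "asymptotically_stable n A"
    and hankel: "hankel_singular_values n A B C \<sigma>"
    and hankel_distinct: "inj_on \<sigma> {..<n}"
    and hankel_nonzero: "\<forall>i<n. \<sigma> i \<noteq> 0"
    and degree: "3 \<le> d"
    and Ec: "near_origin n (\<lambda>x. controllability_energy n m f g x (Ec x))"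
    and Eo: "near_origin n (\<lambda>x. observability_energy n m f g h x (Eo x))"
    and Ec_expansion: "energy_expansion n d Ec v"
    and Eo_expansion: "energy_expansion n d Eo w"
    and V2: "sym_pos_def n V2" "v 2 = vectorize V2"
    and W2: "sym_pos_def n W2" "w 2 = vectorize W2"
    and R: "R \<in> carrier_mat n n" "V2 = R * transpose_mat R"
    and L: "L \<in> carrier_mat n n" "W2 = L * transpose_mat L"
    and Rinv: "Rinv \<in> carrier_mat n n" "inverts_mat R Rinv" "inverts_mat Rinv R"
    and svd: "singular_value_decomposition n (transpose_mat L * transpose_mat Rinv) U \<sigma> V"
    and T1: "T1 = transpose_mat Rinv * V"
    and v': "\<forall>i\<in>{3..d}. v' i = transpose_mat (kron_pow T1 i) *\<^sub>v v i"
    and w': "\<forall>i\<in>{3..d}. w' i = transpose_mat (kron_pow T1 i) *\<^sub>v w i"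
  shows "\<forall>k\<in>{3..d}. \<forall>ms. monomial_order n k ms \<longrightarrow>
    (\<forall>T :: nat \<Rightarrow> real mat.
       T 1 = 1\<^sub>m n \<longrightarrow> (\<forall>i\<in>{2..k-2}. T i \<in> carrier_mat n (n ^ i)) \<longrightarrow>
       (\<exists>X\<in>carrier_mat n (n ^ (k-1)).
          2 \<cdot>\<^sub>v (N_mat n k ms *\<^sub>v vectorize X)
            = - (N_mat n k ms *\<^sub>v
                 (finsum_vec TYPE(real) (n ^ k)
                    (\<lambda>(i, j). vectorize (transpose_mat (T j) * T i))
                    {(i, j). 2 \<le> i \<and> 2 \<le> j \<and> i + j = k}
                  + finsum_vec TYPE(real) (n ^ k)
                    (\<lambda>i. transpose_mat (cal_T n T i k) *\<^sub>v v' i) {3..k})) \<and>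
          2 \<cdot>\<^sub>v ((N_hat_mat n k ms * kron (1\<^sub>m (n ^ (k-1))) (mat_diag n \<sigma> ^\<^sub>m 2)) *\<^sub>v vectorize X)
            = - (N_hat_mat n k ms *\<^sub>v
                 (finsum_vec TYPE(real) (n ^ k)
                    (\<lambda>(i, j). vectorize (transpose_mat (T j) * mat_diag n \<sigma> ^\<^sub>m 2 * T i))
                    {(i, j). 2 \<le> i \<and> 2 \<le> j \<and> i + j = k}
                  + finsum_vec TYPE(real) (n ^ k)
                    (\<lambda>i. transpose_mat (cal_T n T i k) *\<^sub>v w' i) {3..k}))))"
proof (intro ballI allI impI, goal_cases)
  case (1 k ms T)
  have k: "k \<ge> 3" and T: "\<And>i. i \<in> {2..k-2} \<Longrightarrow> T i \<in> carrier_mat n (n ^ i)" using 1 by auto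
  have sq: "mat_diag n \<sigma> ^\<^sub>m 2 = mat_diag n (\<lambda>i. (\<sigma> i)\<^sup>2)"
    by (simp add: numeral_2_eq_2 power2_eq_square)
  \<comment> \<open>Squaring keeps the singular values distinct because they are
    nonnegative.\<close>
  have inj: "inj_on (\<lambda>i. (\<sigma> i)\<^sup>2) {..<n}"
    using hankel hankel_distinct
    by (auto simp: hankel_singular_values_def inj_on_def power2_eq_iff_nonneg)
  \<comment> \<open>From \<open>i, j\<close> at least 2 and \<open>i + j = k\<close> both indices
    are at most \<open>k - 2\<close>, the range in which the sizes of \<open>T\<close> are given.
    \<open>D\<close> will be the squared diagonal matrix.\<close>
  have quad: "vectorize (transpose_mat (T j) * D * T i) \<in> carrier_vec (n ^ k)"
    "vectorize (transpose_mat (T j) * T i) \<in> carrier_vec (n ^ k)"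
    if "2 \<le> i" "2 \<le> j" "i + j = k" for i j D
  proof -
    have "n ^ j * n ^ i = n ^ k"
      using that(3) by (metis add.commute power_add)
    moreover have "dim_col (T i) = n ^ i" "dim_col (T j) = n ^ j"
      using that by (auto intro!: T[THEN carrier_matD(2)])
    ultimately show "vectorize (transpose_mat (T j) * D * T i) \<in> carrier_vec (n ^ k)"
      "vectorize (transpose_mat (T j) * T i) \<in> carrier_vec (n ^ k)"
      by (simp_all only: vectorize_def index_mult_mat(2,3) index_transpose_mat(2) vec_carrier)
  qed
  then have quad_Pi:
    "(\<lambda>(i, j). vectorize (transpose_mat (T j) * D * T i))
      \<in> {(i, j). 2 \<le> i \<and> 2 \<le> j \<and> i + j = k} \<rightarrow> carrier_vec (n ^ k)"
    "(\<lambda>(i, j). vectorize (transpose_mat (T j) * T i))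
      \<in> {(i, j). 2 \<le> i \<and> 2 \<le> j \<and> i + j = k} \<rightarrow> carrier_vec (n ^ k)" for D
    by (simp_all only: Pi_iff Ball_def split_paired_All mem_Collect_eq prod.case) blast+
  \<comment> \<open>The dimension is built into \<open>cal_T\<close>; a general \<open>z\<close>
    serves both \<open>v'\<close> and \<open>w'\<close>.\<close>
  have higher: "transpose_mat (cal_T n T i k) *\<^sub>v z \<in> carrier_vec (n ^ k)" for i z
    by (rule carrier_vecI) (simp add: cal_T_def)
  show ?case
    unfolding sq
  proof (rule ex_coefficient_solution[OF inj _ 1(2)])
    show "0 < k" using k by simp
  qed (intro add_carrier_vec finsum_vec_closed quad_Pi higher Pi_I)+
qed

end
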